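(* Let $P\subset\mathbb{R}_{\ge 0}^d$ be a $d$-dimensional lattice polytope contained in the nonnegative orthant, let $\mathcal{A}=P\cap\mathbb{Z}^d$, and let $T$ be a regular, dense and foldable triangulation of $P$ such that the standard simplex $\Delta_d=\operatorname{conv}\{0,e_1,\dots,e_d\}$ is a maximal cell of $T$. Let $\ell:\mathcal{A}\to\{0,1,\dots,d\}$ be a proper coloring of the vertices of $T$, let $\mathcal{A}_i=\{a\in\mathcal{A}\mid \ell(a)=i\}$, and let $\kappa=(\kappa_a)_{a\in\mathcal{A}}$ be positive real constants. Then there exists a height function $\omega:\mathcal{A}\to\mathbb{N}$ inducing $T$ such that, for all except finitely many values of $t\in\mathbb{R}\setminus\{0\}$, the system $$f_0=f_1=\dots=f_d=0,\qquad f_i(x)=\sum_{a\in\mathcal{A}_i}t^{\omega(a)}\kappa_a x^a\quad(0\le i\le d),$$ in the unknowns $x=(x_1,\dots,x_d)$ has no solutions in the entire space $\mathbb{C}^d$.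
   Context: A lattice polytope in $\mathbb{R}^d$ is the convex hull of finitely many points of $\mathbb{Z}^d$. A triangulation $T$ of $P$ (with vertices in $\mathcal{A}=P\cap\mathbb{Z}^d$) is dense if its vertex set is all of $\mathcal{A}$. It is foldable if its graph ($1$-skeleton) admits a proper coloring with $d+1$ colors, i.e. a map $\ell:\mathcal{A}\to\{0,\dots,d\}$ such that the endpoints of every edge of $T$ have different colors. A height function $\omega:\mathcal{A}\to\mathbb{N}$ (nonnegative integers) induces $T$ if $T$ is the image of the lower convex hull of the lifted points $\{(a,\omega(a))\mid a\in\mathcal{A}\}\subset\mathbb{R}^{d+1}$ under the orthogonal projection omitting the last coordinate; $T$ is regular if it is induced by some height function. For $a\in\mathbb{Z}_{\ge0}^d$, $x^a=x_1^{a_1}\cdots x_d^{a_d}$. The vectors $e_1,\dots,e_d$ are the standard basis vectors of $\mathbb{R}^d$. *)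

theory Defs
  imports "HOL-Analysis.Analysis"
begin

text \<open>
  The dimension \<open>d\<close> is \<open>CARD('d)\<close>; lattice points are vectors of type \<open>real ^ 'd\<close> with integer
  coordinates.
\<close>

definition lattice_points :: "(real ^ 'd) set \<Rightarrow> (real ^ 'd) set" where
  "lattice_points P = {a \<in> P. \<forall>i. a $ i \<in> \<int>}"

definition lattice_polytope :: "(real ^ 'd) set \<Rightarrow> bool" where
  "lattice_polytope P \<longleftrightarrow> (\<exists>S. finite S \<and> S \<subseteq> lattice_points UNIV \<and> P = convex hull S)"

definition vertices :: "(real ^ 'd) set set \<Rightarrow> (real ^ 'd) set" where
  "vertices T = {v. {v} \<in> T}"

text \<open>
  A triangulation is given by the set of all its cells. Since \<open>simplicial_complex\<close> is closed under
  \<open>face_of\<close>, and the empty set is a face, the empty cell belongs to it.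
\<close>

definition lattice_triangulation :: "(real ^ 'd) set \<Rightarrow> (real ^ 'd) set set \<Rightarrow> bool" where
  "lattice_triangulation P T \<longleftrightarrow>
     simplicial_complex T \<and> \<Union>T = P \<and> vertices T \<subseteq> lattice_points P"

definition dense_triangulation :: "(real ^ 'd) set \<Rightarrow> (real ^ 'd) set set \<Rightarrow> bool" where
  "dense_triangulation P T \<longleftrightarrow> vertices T = lattice_points P"

definition proper_coloring ::
    "(real ^ 'd) set \<Rightarrow> (real ^ 'd) set set \<Rightarrow> (real ^ 'd \<Rightarrow> nat) \<Rightarrow> bool" where
  "proper_coloring P T l \<longleftrightarrow>
     l \<in> lattice_points P \<rightarrow> {0..CARD('d)} \<and>
     (\<forall>a b. a \<noteq> b \<and> closed_segment a b \<in> T \<longrightarrow> l a \<noteq> l b)"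

definition foldable :: "(real ^ 'd) set \<Rightarrow> (real ^ 'd) set set \<Rightarrow> bool" where
  "foldable P T \<longleftrightarrow> (\<exists>l. proper_coloring P T l)"

definition lifted_hull :: "(real ^ 'd) set \<Rightarrow> (real ^ 'd \<Rightarrow> nat) \<Rightarrow> ((real ^ 'd) \<times> real) set" where
  "lifted_hull P \<omega> = convex hull ((\<lambda>a. (a, real (\<omega> a))) ` lattice_points P)"

text \<open>
  A lower face is a face on which a linear functional \<open>(u, 1)\<close> with positive last coordinate attains
  its minimum, i.e. one with an outer normal vector pointing downwards. A bound \<open>b\<close> that is not
  attained gives the empty face.
\<close>

definition lower_faces :: "((real ^ 'd) \<times> real) set \<Rightarrow> ((real ^ 'd) \<times> real) set set" where
  "lower_faces Q = {F. \<exists>u b. (\<forall>(x, h) \<in> Q. b \<le> u \<bullet> x + h) \<and> F = {(x, h) \<in> Q. u \<bullet> x + h = b}}"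

text \<open>Only the values of \<open>\<omega>\<close> on the lattice points of \<open>P\<close> matter.\<close>

definition induces ::
    "(real ^ 'd) set \<Rightarrow> (real ^ 'd \<Rightarrow> nat) \<Rightarrow> (real ^ 'd) set set \<Rightarrow> bool" where
  "induces P \<omega> T \<longleftrightarrow> T = (\<lambda>F. fst ` F) ` lower_faces (lifted_hull P \<omega>)"

definition regular_triangulation :: "(real ^ 'd) set \<Rightarrow> (real ^ 'd) set set \<Rightarrow> bool" where
  "regular_triangulation P T \<longleftrightarrow> (\<exists>\<omega>. induces P \<omega> T)"

definition standard_simplex :: "(real ^ 'd) set" where
  "standard_simplex = convex hull (insert 0 (range (\<lambda>i. axis i 1)))"

definition maximal_cell :: "(real ^ 'd) set set \<Rightarrow> (real ^ 'd) set \<Rightarrow> bool" where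
  "maximal_cell T S \<longleftrightarrow> S \<in> T \<and> (\<forall>S' \<in> T. S \<subseteq> S' \<longrightarrow> S' = S)"

text \<open>Meaningful only for exponent vectors \<open>a\<close> with nonnegative integer coordinates.\<close>

definition monomial :: "real ^ 'd \<Rightarrow> complex ^ 'd \<Rightarrow> complex" where
  "monomial a x = (\<Prod>i\<in>UNIV. (x $ i) ^ nat \<lfloor>a $ i\<rfloor>)"

definition system_poly ::
    "(real ^ 'd) set \<Rightarrow> (real ^ 'd \<Rightarrow> nat) \<Rightarrow> (real ^ 'd \<Rightarrow> nat) \<Rightarrow> (real ^ 'd \<Rightarrow> real)
      \<Rightarrow> real \<Rightarrow> nat \<Rightarrow> complex ^ 'd \<Rightarrow> complex" where
  "system_poly P l \<omega> \<kappa> t i x =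
     (\<Sum>a | a \<in> lattice_points P \<and> l a = i. of_real (t ^ \<omega> a * \<kappa> a) * monomial a x)"

end

theory Submission
  imports Defs "HOL-Computational_Algebra.Polynomial"
begin

text \<open>
  Every \<open>\<omega>\<close> inducing \<open>T\<close> works. Fix \<open>N > d + 1\<close> and let \<open>b\<close> range over the lattice points of \<open>N P\<close>.
  Each \<open>b\<close> lies in the cone over a cell of \<open>T\<close>, with a vertex \<open>a\<close> of coefficient greater than \<open>1\<close>;
  multiplying \<open>f\<^sub>i\<close>, where \<open>i = l a\<close>, by \<open>x\<^bsup>b - a\<^esup>\<close> gives a linear equation between the monomials
  \<open>x\<^sup>b\<close> whose diagonal term is \<open>\<kappa>\<^sub>a t\<^bsup>\<omega> a\<^esup> x\<^sup>b\<close>. Let \<open>W b\<close> be \<open>N\<close> times the value at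
  \<open>b / N\<close> of the convex function on \<open>P\<close> that extends \<open>\<omega>\<close> affinely over each cell of \<open>T\<close>.
  As vertices of one colour never share a cell, every other term has, relative to the weights \<open>t\<^bsup>W b\<^esup>\<close>,
  a strictly larger order in \<open>t\<close>, so for small \<open>t > 0\<close> the square system is diagonally dominant and hence nonsingular. It is polynomial
  in \<open>t\<close>, so it is nonsingular for all but finitely many \<open>t\<close>; but a common zero \<open>x\<close> would put the
  vector of all \<open>x\<^sup>b\<close>, which is \<open>1\<close> at \<open>b = 0\<close>, into the kernel.
\<close>

section \<open>Linear systems depending on a parameter\<close>

text \<open>Injectivity of a matrix, phrased without determinants and with separate row and column
  sets, so that elimination can drop a column while keeping every row.\<close>

definition trivial_kernel :: "'r set \<Rightarrow> 'c set \<Rightarrow> ('r \<Rightarrow> 'c \<Rightarrow> 'a::field) \<Rightarrow> bool" where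
  "trivial_kernel R C M \<longleftrightarrow> (\<forall>v. (\<forall>r\<in>R. (\<Sum>c\<in>C. M r c * v c) = 0) \<longrightarrow> (\<forall>c\<in>C. v c = 0))"

text \<open>One step of Gaussian elimination, free of division so that polynomial entries stay
  polynomial. The pivot row remains but becomes zero.\<close>

lemma trivial_kernel_pivot:
  assumes "finite C" "c0 \<notin> C" "r0 \<in> R" and p: "M r0 c0 \<noteq> 0"
  shows "trivial_kernel R (insert c0 C) M \<longleftrightarrow>
    trivial_kernel R C (\<lambda>r c. M r0 c0 * M r c - M r c0 * M r0 c)"
    (is "_ \<longleftrightarrow> trivial_kernel R C ?M'")
proof
  have row: "(\<Sum>c\<in>C. ?M' r c * v c) =
      M r0 c0 * (\<Sum>c\<in>C. M r c * v c) - M r c0 * (\<Sum>c\<in>C. M r0 c * v c)" for r v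
    by (simp add: sum_subtractf sum_distrib_left left_diff_distrib mult.assoc)
  show "trivial_kernel R C ?M'" if L: "trivial_kernel R (insert c0 C) M"
    unfolding trivial_kernel_def
  proof (intro allI impI)
    fix v assume v: "\<forall>r\<in>R. (\<Sum>c\<in>C. ?M' r c * v c) = 0"
    \<comment> \<open>The value at \<open>c0\<close> is the one forced by row
      \<open>r0\<close>.\<close>
    define w where "w = v(c0 := - (\<Sum>c\<in>C. M r0 c * v c) / M r0 c0)"
    have "(\<Sum>c\<in>insert c0 C. M r c * w c) = 0" if "r \<in> R" for r
    proof -
      have "(\<Sum>c\<in>C. M r c * w c) = (\<Sum>c\<in>C. M r c * v c)"
        using assms(2) by (intro sum.cong) (auto simp: w_def)
      moreover have "M r0 c0 * (\<Sum>c\<in>C. M r c * v c) = M r c0 * (\<Sum>c\<in>C. M r0 c * v c)"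
        using v that row[of r v] by simp
      ultimately show ?thesis
        using assms by (simp add: w_def field_simps)
    qed
    then have "\<forall>c\<in>insert c0 C. w c = 0"
      using L unfolding trivial_kernel_def by blast
    then show "\<forall>c\<in>C. v c = 0"
      using assms(2) by (metis fun_upd_other insertCI w_def)
  qed
  show "trivial_kernel R (insert c0 C) M" if L: "trivial_kernel R C ?M'"
    unfolding trivial_kernel_def
  proof (intro allI impI)
    fix v assume "\<forall>r\<in>R. (\<Sum>c\<in>insert c0 C. M r c * v c) = 0"
    then have v: "(\<Sum>c\<in>C. M r c * v c) = - M r c0 * v c0" if "r \<in> R" for r
      using that assms(1,2) by (simp add: add_eq_0_iff2)
    have "\<forall>r\<in>R. (\<Sum>c\<in>C. ?M' r c * v c) = 0"
      using v assms(3) by (simp add: row)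
    then have "\<forall>c\<in>C. v c = 0"
      using L unfolding trivial_kernel_def by blast
    moreover from this have "v c0 = 0"
      using v[OF assms(3)] p by simp
    ultimately show "\<forall>c\<in>insert c0 C. v c = 0"
      by simp
  qed
qed

text \<open>Induction on the columns: elimination with a nonzero polynomial as pivot is valid away
  from its finitely many roots, so both the infinite set of good parameters and the finiteness of
  the bad set pass through each step.\<close>

lemma finite_nontrivial_kernel:
  fixes M :: "'r \<Rightarrow> 'c \<Rightarrow> 'a::field poly"
  assumes "finite C" "infinite {t. trivial_kernel R C (\<lambda>r c. poly (M r c) t)}"
  shows "finite {t. \<not> trivial_kernel R C (\<lambda>r c. poly (M r c) t)}"
  using assms
proof (induction C arbitrary: M)
  case empty
  then show ?case by (simp add: trivial_kernel_def)
next
  case (insert c0 C)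
  \<comment> \<open>If the whole column were the zero polynomial, the unit vector at
    \<open>c0\<close> would be in the kernel for every \<open>t\<close>.\<close>
  obtain r0 where r0: "r0 \<in> R" "M r0 c0 \<noteq> 0"
  proof (rule ccontr)
    assume "\<not> thesis"
    with that have 0: "M r c0 = 0" if "r \<in> R" for r
      using that by blast
    have "\<not> trivial_kernel R (insert c0 C) (\<lambda>r c. poly (M r c) t)" for t
      unfolding trivial_kernel_def
    proof
      assume *: "\<forall>v. (\<forall>r\<in>R. (\<Sum>c\<in>insert c0 C. poly (M r c) t * v c) = 0) \<longrightarrow>
        (\<forall>c\<in>insert c0 C. v c = 0)"
      have "(\<Sum>c\<in>insert c0 C. poly (M r c) t * of_bool (c = c0)) = 0" if "r \<in> R" for r
        using that 0 by (intro sum.neutral) auto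
      with * show False
        by (auto dest!: spec[of _ "\<lambda>c. of_bool (c = c0)"])
    qed
    with insert.prems show False by simp
  qed
  define M' where "M' r c = M r0 c0 * M r c - M r c0 * M r0 c" for r c
  have roots: "finite {t. poly (M r0 c0) t = 0}"
    using r0 poly_roots_finite by blast
  have iff: "trivial_kernel R (insert c0 C) (\<lambda>r c. poly (M r c) t) \<longleftrightarrow>
      trivial_kernel R C (\<lambda>r c. poly (M' r c) t)" if "poly (M r0 c0) t \<noteq> 0" for t
    using trivial_kernel_pivot[OF insert.hyps(1,2) r0(1), of "\<lambda>r c. poly (M r c) t"] that
    by (simp add: M'_def)
  have "infinite {t. trivial_kernel R C (\<lambda>r c. poly (M' r c) t)}"
  proof
    assume "finite {t. trivial_kernel R C (\<lambda>r c. poly (M' r c) t)}"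
    from finite_UnI[OF this roots] show False
      using insert.prems iff by (elim notE finite_subset[rotated]) auto
  qed
  from finite_UnI[OF insert.IH[OF this] roots] show ?case
    using iff by (elim finite_subset[rotated]) auto
qed

text \<open>The substitution \<open>v b \<mapsto> t\<^sup>W v b\<close> makes the system diagonally dominant as \<open>t\<close> tends to \<open>0\<close>.\<close>

lemma weighted_dominance:
  fixes W :: "'b \<Rightarrow> real" and \<omega> :: "'c \<Rightarrow> nat" and \<kappa> :: "'c \<Rightarrow> real"
    and s :: "'b \<Rightarrow> 'c \<Rightarrow> 'b"
  assumes B: "finite B" and K: "\<And>b. b \<in> B \<Longrightarrow> finite (K b)"
    and \<pi>: "\<And>b. b \<in> B \<Longrightarrow> \<pi> b \<in> K b" "\<And>b. b \<in> B \<Longrightarrow> 0 < \<kappa> (\<pi> b)"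
    and s: "\<And>b. b \<in> B \<Longrightarrow> s b (\<pi> b) = b" "\<And>b c. b \<in> B \<Longrightarrow> c \<in> K b \<Longrightarrow> s b c \<in> B"
    and W: "\<And>b c. b \<in> B \<Longrightarrow> c \<in> K b \<Longrightarrow> c \<noteq> \<pi> b \<Longrightarrow> W (s b c) < W b - \<omega> (\<pi> b) + \<omega> c"
  shows "\<forall>\<^sub>F t in at_right 0. \<forall>v :: 'b \<Rightarrow> complex.
    (\<forall>b\<in>B. (\<Sum>c\<in>K b. of_real (t ^ \<omega> c * \<kappa> c) * v (s b c)) = 0) \<longrightarrow> (\<forall>b\<in>B. v b = 0)"
proof -
  \<comment> \<open>The order in \<open>t\<close> of an off-diagonal coefficient once the row is
    scaled and the unknowns are weighted; \<open>W\<close> makes it positive.\<close>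
  define e where "e b c = W b - \<omega> (\<pi> b) + \<omega> c - W (s b c)" for b c
  have "((\<lambda>t. \<Sum>c\<in>K b - {\<pi> b}. \<bar>\<kappa> c\<bar> * t powr e b c) \<longlongrightarrow> 0) (at_right 0)" if "b \<in> B" for b
  proof (intro tendsto_null_sum tendsto_mult_right_zero)
    fix c assume "c \<in> K b - {\<pi> b}"
    then have "0 < e b c" using W[OF that, of c] by (auto simp: e_def)
    then show "((\<lambda>t. t powr e b c) \<longlongrightarrow> 0) (at_right 0)"
      by (intro tendsto_powr' [THEN tendsto_eq_rhs])
        (auto intro!: tendsto_eq_intros eventually_at_right_less simp: eventually_at_filter)
  qed
  then have "\<forall>\<^sub>F t in at_right 0. (\<Sum>c\<in>K b - {\<pi> b}. \<bar>\<kappa> c\<bar> * t powr e b c) < \<kappa> (\<pi> b)"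
    if "b \<in> B" for b
    using \<pi>(2)[OF that] that by (auto dest: order_tendstoD(2))
  then have "\<forall>\<^sub>F t in at_right 0. \<forall>b\<in>B. (\<Sum>c\<in>K b - {\<pi> b}. \<bar>\<kappa> c\<bar> * t powr e b c) < \<kappa> (\<pi> b)"
    using B by (simp add: eventually_ball_finite)
  moreover have "\<forall>\<^sub>F t in at_right (0::real). 0 < t"
    by (rule eventually_at_right_less)
  ultimately show ?thesis
  proof eventually_elim
    case (elim t)
    show ?case
    proof (intro allI impI ballI)
      fix v :: "'b \<Rightarrow> complex" and b0
      assume v: "\<forall>b\<in>B. (\<Sum>c\<in>K b. of_real (t ^ \<omega> c * \<kappa> c) * v (s b c)) = 0" and b0: "b0 \<in> B"
      define w where "w b = t powr W b * cmod (v b)" for b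
      \<comment> \<open>As usual for diagonal dominance, the contradiction comes from the row whose
        unknown has the largest weighted modulus.\<close>
      obtain b where b: "b \<in> B" "\<And>b'. b' \<in> B \<Longrightarrow> w b' \<le> w b"
        proof -
        have "Max (w ` B) \<in> w ` B"
          using B b0 by (intro Max_in) auto
        then obtain b where "b \<in> B" "Max (w ` B) = w b" by blast
        moreover have "w b' \<le> Max (w ` B)" if "b' \<in> B" for b'
          using B that by simp
        ultimately show ?thesis using that by metis
      qed
      have "of_real (t ^ \<omega> (\<pi> b) * \<kappa> (\<pi> b)) * v b =
          - (\<Sum>c\<in>K b - {\<pi> b}. of_real (t ^ \<omega> c * \<kappa> c) * v (s b c))"
        using bspec[OF v b(1)] K[OF b(1)] s(1)[OF b(1)] \<pi>(1)[OF b(1)]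
        by (simp only: sum.remove[of "K b" "\<pi> b"] add_eq_0_iff2)
      then have "cmod (of_real (t ^ \<omega> (\<pi> b) * \<kappa> (\<pi> b)) * v b) \<le>
          (\<Sum>c\<in>K b - {\<pi> b}. cmod (of_real (t ^ \<omega> c * \<kappa> c) * v (s b c)))"
        by (simp only: norm_minus_cancel norm_sum)
      then have "t ^ \<omega> (\<pi> b) * \<kappa> (\<pi> b) * cmod (v b) \<le>
          (\<Sum>c\<in>K b - {\<pi> b}. t ^ \<omega> c * \<bar>\<kappa> c\<bar> * cmod (v (s b c)))"
        using elim(2) \<pi>(2)[OF b(1)] by (simp add: norm_mult norm_power)
      \<comment> \<open>This row scaling turns the diagonal coefficient into the constant
        \<open>\<kappa> (\<pi> b)\<close>.\<close>
      then have "t powr (W b - \<omega> (\<pi> b)) * (t ^ \<omega> (\<pi> b) * \<kappa> (\<pi> b) * cmod (v b)) \<le>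
          t powr (W b - \<omega> (\<pi> b)) * (\<Sum>c\<in>K b - {\<pi> b}. t ^ \<omega> c * \<bar>\<kappa> c\<bar> * cmod (v (s b c)))"
        by (rule mult_left_mono) simp
      also have "t powr (W b - \<omega> (\<pi> b)) * (t ^ \<omega> (\<pi> b) * \<kappa> (\<pi> b) * cmod (v b)) = \<kappa> (\<pi> b) * w b"
        using elim(2) by (simp add: w_def powr_diff powr_realpow)
      also have "t powr (W b - \<omega> (\<pi> b)) * (\<Sum>c\<in>K b - {\<pi> b}. t ^ \<omega> c * \<bar>\<kappa> c\<bar> * cmod (v (s b c)))
          = (\<Sum>c\<in>K b - {\<pi> b}. \<bar>\<kappa> c\<bar> * t powr e b c * w (s b c))"
        using elim(2)
        by (simp add: sum_distrib_left e_def w_def powr_diff powr_add powr_realpow field_simps)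
      also have "\<dots> \<le> (\<Sum>c\<in>K b - {\<pi> b}. \<bar>\<kappa> c\<bar> * t powr e b c * w b)"
        using b s(2) by (intro sum_mono mult_left_mono) auto
      also have "\<dots> = (\<Sum>c\<in>K b - {\<pi> b}. \<bar>\<kappa> c\<bar> * t powr e b c) * w b"
        by (simp add: sum_distrib_right)
      finally have "w b \<le> 0"
        using elim(1) b(1) by (meson mult_less_cancel_right_pos not_le)
      then have "w b0 \<le> 0"
        using b(2)[OF b0] by linarith
      then show "v b0 = 0"
        using elim(2) by (simp add: w_def mult_le_0_iff)
    qed
  qed
qed


section \<open>Lattice points and monomials\<close>

lemma lattice_points_closed:
  assumes "a \<in> lattice_points UNIV" "b \<in> lattice_points UNIV"
  shows "a + b \<in> lattice_points UNIV" "a - b \<in> lattice_points UNIV"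
  using assms by (auto simp: lattice_points_def)

lemma finite_lattice_points_bounded:
  fixes S :: "(real ^ 'd) set"
  assumes "bounded S"
  shows "finite (lattice_points S)"
proof -
  obtain K where K: "\<And>x. x \<in> S \<Longrightarrow> norm x \<le> K"
    using assms by (auto simp: bounded_iff)
  have "vec_nth ` lattice_points S \<subseteq> PiE UNIV (\<lambda>_. {k \<in> \<int>. \<bar>k\<bar> \<le> K})"
    by (auto simp: lattice_points_def intro: order_trans[OF component_le_norm_cart] K)
  then have "finite (vec_nth ` lattice_points S)"
    by (rule finite_subset) (simp add: finite_PiE finite_abs_int_segment)
  then show ?thesis
    by (rule finite_imageD) (simp add: inj_on_def vec_nth_inject)
qed

lemma nat_floor_add_Ints:
  fixes x y :: real
  assumes "x \<in> \<int>" "y \<in> \<int>" "0 \<le> x" "0 \<le> y"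
  shows "nat \<lfloor>x + y\<rfloor> = nat \<lfloor>x\<rfloor> + nat \<lfloor>y\<rfloor>"
  using assms by (auto elim!: Ints_cases simp: nat_add_distrib)

text \<open>Nonnegativity matters because \<open>nat\<close> truncates negative exponents to 0,
  which destroys additivity.\<close>

lemma monomial_add:
  assumes "a \<in> lattice_points UNIV" "b \<in> lattice_points UNIV"
    and "\<forall>i. 0 \<le> a $ i" "\<forall>i. 0 \<le> b $ i"
  shows "monomial (a + b) x = monomial a x * monomial b x"
proof -
  have "nat \<lfloor>(a + b) $ i\<rfloor> = nat \<lfloor>a $ i\<rfloor> + nat \<lfloor>b $ i\<rfloor>" for i
    unfolding vector_add_component
    by (rule nat_floor_add_Ints) (use assms in \<open>auto simp: lattice_points_def\<close>)
  then show ?thesis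
    by (simp only: monomial_def power_add prod.distrib)
qed

section \<open>Cells of an induced triangulation and their supporting functionals\<close>

locale induced_triangulation =
  fixes P :: "(real ^ 'd) set" and T :: "(real ^ 'd) set set" and \<omega> :: "real ^ 'd \<Rightarrow> nat"
  assumes complex: "simplicial_complex T"
    and union: "\<Union>T = P"
    and dense: "vertices T = lattice_points P"
    and induces: "induces P \<omega> T"
begin

lemma singleton_cell_iff: "{a} \<in> T \<longleftrightarrow> a \<in> lattice_points P"
  using dense by (auto simp: vertices_def)

text \<open>By density \<open>{a}\<close> is itself a cell, and cells meet in common faces. Hence
  the lattice points of a cell are exactly its vertices.\<close>

lemma extreme_point_of_cell:
  assumes "S \<in> T" "a \<in> S" "a \<in> lattice_points P"
  shows "a extreme_point_of S"
proof -
  have "S \<inter> {a} face_of S"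
    using complex assms singleton_cell_iff unfolding simplicial_complex_def by blast
  with assms(2) show ?thesis
    by (simp add: face_of_singleton)
qed

text \<open>Any two vertices of a simplex span a face. This is how a coloring of edges keeps equally
  colored vertices out of a common cell.\<close>

lemma segment_in_cell:
  assumes "S \<in> T" "a \<in> S" "a \<in> lattice_points P" "c \<in> S" "c \<in> lattice_points P"
  shows "closed_segment a c \<in> T"
proof -
  obtain C where C: "\<not> affine_dependent C" "S = convex hull C"
    using complex assms(1) unfolding simplicial_complex_def simplex_def by blast
  have "{a, c} \<subseteq> C"
    using extreme_point_of_cell[OF assms(1)] assms(2-)
    by (simp add: C extreme_point_of_convex_hull_affine_independent)
  then have "closed_segment a c face_of S"
    unfolding C(2) segment_convex_hull face_of_convex_hull_affine_independent[OF C(1)] by blast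
  with complex assms(1) show ?thesis
    unfolding simplicial_complex_def by blast
qed

text \<open>The affine function \<open>\<beta> - u \<bullet> x\<close> is a minorant of the heights
  that can touch them only over \<open>S\<close>. Touching at every lattice point of
  \<open>S\<close> is a separate matter, settled in \<open>cell_supports\<close>.\<close>

definition supports :: "(real ^ 'd) set \<Rightarrow> real ^ 'd \<Rightarrow> real \<Rightarrow> bool" where
  "supports S u \<beta> \<longleftrightarrow>
     (\<forall>a\<in>lattice_points P. \<beta> \<le> u \<bullet> a + \<omega> a \<and> (u \<bullet> a + \<omega> a = \<beta> \<longrightarrow> a \<in> S))"

lemma lifted_point_in_lifted_hull:
  "a \<in> lattice_points P \<Longrightarrow> (a, real (\<omega> a)) \<in> lifted_hull P \<omega>"
  unfolding lifted_hull_def by (rule hull_inc) simp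

lemma cellE:
  assumes "S \<in> T"
  obtains u \<beta> where "\<And>x h. (x, h) \<in> lifted_hull P \<omega> \<Longrightarrow> \<beta> \<le> u \<bullet> x + h"
    and "\<And>x. x \<in> S \<longleftrightarrow> (\<exists>h. (x, h) \<in> lifted_hull P \<omega> \<and> u \<bullet> x + h = \<beta>)"
    and "supports S u \<beta>"
proof -
  obtain F where F: "F \<in> lower_faces (lifted_hull P \<omega>)" "S = fst ` F"
    using assms induces unfolding induces_def by blast
  then obtain u \<beta> where le: "\<And>x h. (x, h) \<in> lifted_hull P \<omega> \<Longrightarrow> \<beta> \<le> u \<bullet> x + h"
    and F': "F = {(x, h) \<in> lifted_hull P \<omega>. u \<bullet> x + h = \<beta>}"
    unfolding lower_faces_def by fast
  have S: "x \<in> S \<longleftrightarrow> (\<exists>h. (x, h) \<in> lifted_hull P \<omega> \<and> u \<bullet> x + h = \<beta>)" for x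
    by (force simp: F(2) F')
  moreover have "supports S u \<beta>"
    unfolding supports_def using le S lifted_point_in_lifted_hull by blast
  ultimately show ?thesis using that le by blast
qed

text \<open>Since \<open>{v}\<close> is a cell, some lower face lies over \<open>v\<close> alone. A
  linear functional on the hull attains its minimum at a generator, here necessarily the lifted
  point of \<open>v\<close>.\<close>

lemma height_le_of_lifted_hull:
  assumes v: "v \<in> lattice_points P" and h: "(v, h) \<in> lifted_hull P \<omega>"
  shows "real (\<omega> v) \<le> h"
proof -
  have "{v} \<in> T" using v by (simp add: singleton_cell_iff)
  then obtain u \<beta> where le: "\<And>x h. (x, h) \<in> lifted_hull P \<omega> \<Longrightarrow> \<beta> \<le> u \<bullet> x + h"
    and S: "\<And>x. x \<in> {v} \<longleftrightarrow> (\<exists>h. (x, h) \<in> lifted_hull P \<omega> \<and> u \<bullet> x + h = \<beta>)"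
    and supp: "supports {v} u \<beta>"
    by (rule cellE) blast
  have "u \<bullet> v + \<omega> v = \<beta>"
  proof (rule ccontr)
    \<comment> \<open>Otherwise all generators, and with them the hull, lie strictly above the
      bound, and the face over \<open>v\<close> is empty.\<close>
    assume neq: "u \<bullet> v + \<omega> v \<noteq> \<beta>"
    have "\<beta> < u \<bullet> a + \<omega> a" if "a \<in> lattice_points P" for a
      using that supp neq unfolding supports_def by (metis order_le_less singletonD)
    then have "lifted_hull P \<omega> \<subseteq> {z. (u, 1) \<bullet> z > \<beta>}"
      unfolding lifted_hull_def
      by (intro hull_minimal convex_halfspace_gt) auto
    then show False
      using S[of v] by auto
  qed
  with le[OF h] show ?thesis by simp
qed

text \<open>Lying in \<open>S\<close> only yields some height over \<open>v\<close> on the lower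
  face; as \<open>\<omega> v\<close> is the least height over \<open>v\<close>, the two
  agree.\<close>

lemma cell_supports:
  assumes "S \<in> T"
  obtains u \<beta> where "supports S u \<beta>"
    and "\<And>v. v \<in> S \<Longrightarrow> v \<in> lattice_points P \<Longrightarrow> u \<bullet> v + \<omega> v = \<beta>"
proof -
  obtain u \<beta> where le: "\<And>x h. (x, h) \<in> lifted_hull P \<omega> \<Longrightarrow> \<beta> \<le> u \<bullet> x + h"
    and S: "\<And>x. x \<in> S \<longleftrightarrow> (\<exists>h. (x, h) \<in> lifted_hull P \<omega> \<and> u \<bullet> x + h = \<beta>)"
    and supp: "supports S u \<beta>"
    using assms by (rule cellE) blast
  have "u \<bullet> v + \<omega> v = \<beta>" if v: "v \<in> S" "v \<in> lattice_points P" for v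
  proof -
    obtain h where h: "(v, h) \<in> lifted_hull P \<omega>" "u \<bullet> v + h = \<beta>"
      using S v(1) by blast
    then show ?thesis
      using height_le_of_lifted_hull[OF v(2) h(1)] le[OF lifted_point_in_lifted_hull[OF v(2)]]
      by linarith
  qed
  with that supp show ?thesis by blast
qed

text \<open>A point \<open>b\<close> of the dilate \<open>N P\<close> has barycentric coordinates of sum \<open>N\<close> in its cell.
  Since \<open>N\<close> exceeds the number of vertices of a cell, some coordinate exceeds \<open>1\<close>, so its vertex
  \<open>a\<close> can be split off from \<open>b\<close> while still remaining a vertex of the carrier of \<open>b - a\<close>.\<close>

lemma pivot:
  assumes convex: "convex P" and N: "N > real CARD('d) + 1" and p: "p \<in> P"
  obtains a S u \<beta> where "a \<in> lattice_points P" "S \<in> T" "p \<in> S" "supports S u \<beta>"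
    "(1 / (N - 1)) *\<^sub>R (N *\<^sub>R p - a) \<in> P"
    "\<And>S' u' \<beta>' c. S' \<in> T \<Longrightarrow> supports S' u' \<beta>' \<Longrightarrow> c \<in> lattice_points P \<Longrightarrow>
      \<not> {a, c} \<subseteq> S' \<Longrightarrow>
      N * \<beta>' - u' \<bullet> (N *\<^sub>R p - a + c) < N * \<beta> - u \<bullet> (N *\<^sub>R p) - \<omega> a + \<omega> c"
proof -
  obtain S where S: "S \<in> T" "p \<in> S" using p union by blast
  obtain C where C: "\<not> affine_dependent C" "S = convex hull C" "finite C"
    using complex S(1) unfolding simplicial_complex_def simplex by blast
  have sub: "C \<subseteq> lattice_points P"
  proof
    fix v assume "v \<in> C"
    then have "{v} face_of S"
      by (simp add: C face_of_singleton extreme_point_of_convex_hull_affine_independent)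
    then have "{v} \<in> T"
      using complex S(1) unfolding simplicial_complex_def by blast
    then show "v \<in> lattice_points P" by (simp add: singleton_cell_iff)
  qed
  have "int (card C) \<le> int CARD('d) + 1"
    using aff_dim_affine_independent[OF C(1)] aff_dim_le_DIM[of C] by simp
  then have card: "real (card C) < N" using N by linarith
  obtain \<mu> where \<mu>: "\<And>v. v \<in> C \<Longrightarrow> 0 \<le> \<mu> v" "sum \<mu> C = 1" "(\<Sum>v\<in>C. \<mu> v *\<^sub>R v) = p"
    using S(2) by (auto simp: C convex_hull_finite)
  obtain a where a: "a \<in> C" "1 < N * \<mu> a"
  proof (rule ccontr)
    assume "\<not> thesis"
    with that have "(\<Sum>v\<in>C. N * \<mu> v) \<le> (\<Sum>v\<in>C. 1)"
      by (intro sum_mono) fastforce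
    then show False using card \<mu>(2) by (simp add: sum_distrib_left[symmetric])
  qed
  \<comment> \<open>Coordinates of \<open>N *\<^sub>R p - a\<close> in the same cell; the weight at
    \<open>a\<close> stays positive, which later yields strictness.\<close>
  define \<nu> where "\<nu> v = N * \<mu> v - of_bool (v = a)" for v
  have N1: "1 < N" using N by simp
  have \<nu>0: "0 \<le> \<nu> v" if "v \<in> C" for v
    using a(2) \<mu>(1)[OF that] N1 by (cases "v = a") (auto simp: \<nu>_def)
  have \<nu>a: "0 < \<nu> a" using a(2) by (simp add: \<nu>_def)
  have \<nu>1: "sum \<nu> C = N - 1"
    using a(1) C(3) \<mu>(2) by (simp add: \<nu>_def sum_subtractf sum_distrib_left[symmetric])
  have \<nu>p: "(\<Sum>v\<in>C. \<nu> v *\<^sub>R v) = N *\<^sub>R p - a"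
  proof -
    have "(\<Sum>v\<in>C. of_bool (v = a) *\<^sub>R v) = (\<Sum>v\<in>C. if v = a then v else 0)"
      by (intro sum.cong) auto
    then show ?thesis
      using a(1) C(3)
      by (simp add: \<nu>_def scaleR_left_diff_distrib sum_subtractf \<mu>(3)[symmetric] scaleR_sum_right)
  qed
  obtain u \<beta> where supp: "supports S u \<beta>"
    and tight: "\<And>v. v \<in> S \<Longrightarrow> v \<in> lattice_points P \<Longrightarrow> u \<bullet> v + \<omega> v = \<beta>"
    using S(1) by (rule cell_supports) blast
  have CS: "C \<subseteq> S" by (simp add: C hull_subset)
  \<comment> \<open>An affine function is summed exactly by the weights, whose total is
    \<open>N - 1\<close>.\<close>
  have expand: "(\<Sum>v\<in>C. \<nu> v * (\<beta>' - u' \<bullet> v)) = (N - 1) * \<beta>' - u' \<bullet> (N *\<^sub>R p - a)" for u' \<beta>'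
    unfolding \<nu>p[symmetric] \<nu>1[symmetric]
    by (simp add: right_diff_distrib sum_subtractf sum_distrib_right inner_sum_right)
  have heights: "(\<Sum>v\<in>C. \<nu> v * \<omega> v) = N * \<beta> - u \<bullet> (N *\<^sub>R p) - \<omega> a"
  proof -
    have "real (\<omega> v) = \<beta> - u \<bullet> v" if "v \<in> C" for v
      using tight[of v] that CS sub by force
    then have "(\<Sum>v\<in>C. \<nu> v * \<omega> v) = (N - 1) * \<beta> - u \<bullet> (N *\<^sub>R p - a)"
      by (simp add: expand[symmetric])
    then show ?thesis
      using \<open>\<And>v. v \<in> C \<Longrightarrow> real (\<omega> v) = \<beta> - u \<bullet> v\<close>[OF a(1)]
      by (simp add: algebra_simps inner_diff_right)
  qed
  show ?thesis
  proof
    show "a \<in> lattice_points P" using a(1) sub by blast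
    show "S \<in> T" "p \<in> S" "supports S u \<beta>" by fact+
    have "(\<Sum>v\<in>C. (\<nu> v / (N - 1)) *\<^sub>R v) \<in> P"
      using C(3) convex \<nu>0 N1 \<nu>1 sub
      by (intro convex_sum) (auto simp: sum_divide_distrib[symmetric] lattice_points_def)
    then show "(1 / (N - 1)) *\<^sub>R (N *\<^sub>R p - a) \<in> P"
      by (simp add: \<nu>p[symmetric] scaleR_sum_right)
  next
    fix S' u' \<beta>' c
    assume S': "S' \<in> T" "supports S' u' \<beta>'" "c \<in> lattice_points P" "\<not> {a, c} \<subseteq> S'"
    have le: "\<beta>' - u' \<bullet> v \<le> \<omega> v" if "v \<in> lattice_points P" for v
      using S'(2) that unfolding supports_def by fastforce
    have less: "\<beta>' - u' \<bullet> v < \<omega> v" if "v \<in> lattice_points P" "v \<notin> S'" for v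
      using S'(2) that unfolding supports_def by fastforce
    have sum_le: "(\<Sum>v\<in>C. \<nu> v * (\<beta>' - u' \<bullet> v)) \<le> (\<Sum>v\<in>C. \<nu> v * \<omega> v)"
      using sub \<nu>0 le by (intro sum_mono mult_left_mono) auto
    \<comment> \<open>Both \<open>a\<close> and \<open>c\<close> carry positive weight in
      \<open>N *\<^sub>R p - a + c\<close>, so whichever of them misses \<open>S'\<close> makes the
      minorant estimate strict.\<close>
    have "(\<Sum>v\<in>C. \<nu> v * (\<beta>' - u' \<bullet> v)) + (\<beta>' - u' \<bullet> c) < (\<Sum>v\<in>C. \<nu> v * \<omega> v) + \<omega> c"
    proof (cases "c \<in> S'")
      case True
      then have "\<beta>' - u' \<bullet> a < \<omega> a" using S'(4) less a(1) sub by blast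
      then have "(\<Sum>v\<in>C. \<nu> v * (\<beta>' - u' \<bullet> v)) < (\<Sum>v\<in>C. \<nu> v * \<omega> v)"
        using sub \<nu>0 \<nu>a le a(1) C(3)
        by (intro sum_strict_mono_ex1) (auto intro!: mult_left_mono bexI[of _ a])
      with le[OF S'(3)] show ?thesis by simp
    next
      case False
      with sum_le less[OF S'(3)] show ?thesis by simp
    qed
    then show "N * \<beta>' - u' \<bullet> (N *\<^sub>R p - a + c) < N * \<beta> - u \<bullet> (N *\<^sub>R p) - \<omega> a + \<omega> c"
      by (simp add: expand heights inner_add_right left_diff_distrib)
  qed
qed

section \<open>The square system of monomials\<close>

lemma finite_solvable_parameters:
  fixes l :: "real ^ 'd \<Rightarrow> nat" and \<kappa> :: "real ^ 'd \<Rightarrow> real"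
  assumes convex: "convex P" and bounded: "bounded P" and nonneg: "\<forall>x\<in>P. \<forall>i. 0 \<le> x $ i"
    and zero: "0 \<in> P" and col: "proper_coloring P T l"
    and \<kappa>: "\<forall>a\<in>lattice_points P. 0 < \<kappa> a"
  shows "finite {t. \<exists>x. \<forall>i\<in>{0..CARD('d)}. system_poly P l \<omega> \<kappa> t i x = 0}"
proof -
  \<comment> \<open>Exceeds \<open>d + 1\<close>, the largest number of vertices of a cell, as
    \<open>pivot\<close> requires.\<close>
  define N where "N = real CARD('d) + 2"
  have N: "N > real CARD('d) + 1" "N > 1" by (auto simp: N_def)
  define B where "B = {b \<in> lattice_points UNIV. (1 / N) *\<^sub>R b \<in> P}"
  have finA: "finite (lattice_points P)"
    using bounded by (rule finite_lattice_points_bounded)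
  have "B \<subseteq> lattice_points ((*\<^sub>R) N ` P)"
    using N(2) by (auto simp: B_def lattice_points_def intro: rev_image_eqI)
  then have finB: "finite B"
    using finite_subset bounded by (blast intro: finite_lattice_points_bounded bounded_scaling)
  \<comment> \<open>Bundles what \<open>pivot\<close> gives at \<open>p = b / N\<close>, so that
    vertex, cell and functional can be chosen for all \<open>b\<close> at once.\<close>
  define splits where "splits b a S u \<beta> \<longleftrightarrow> a \<in> lattice_points P \<and> S \<in> T \<and> supports S u \<beta> \<and>
      (1 / (N - 1)) *\<^sub>R (b - a) \<in> P \<and>
      (\<forall>S' u' \<beta>' c. S' \<in> T \<longrightarrow> supports S' u' \<beta>' \<longrightarrow> c \<in> lattice_points P \<longrightarrow> \<not> {a, c} \<subseteq> S' \<longrightarrow>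
        N * \<beta>' - u' \<bullet> (b - a + c) < N * \<beta> - u \<bullet> b - \<omega> a + \<omega> c)" for b a S u \<beta>
  have "\<exists>a S u \<beta>. splits b a S u \<beta>" if "b \<in> B" for b
  proof -
    have b: "(1 / N) *\<^sub>R b \<in> P" "N *\<^sub>R ((1 / N) *\<^sub>R b) = b"
      using that N by (auto simp: B_def)
    show ?thesis
      unfolding splits_def by (rule pivot[OF convex N(1) b(1)], unfold b(2)) blast
  qed
  then obtain \<pi> S u \<beta> where splits: "\<And>b. b \<in> B \<Longrightarrow> splits b (\<pi> b) (S b) (u b) (\<beta> b)"
    by metis
  then have \<pi>: "\<And>b. b \<in> B \<Longrightarrow> \<pi> b \<in> lattice_points P"
    and S: "\<And>b. b \<in> B \<Longrightarrow> S b \<in> T" "\<And>b. b \<in> B \<Longrightarrow> supports (S b) (u b) (\<beta> b)"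
    and diff: "\<And>b. b \<in> B \<Longrightarrow> (1 / (N - 1)) *\<^sub>R (b - \<pi> b) \<in> P"
    unfolding splits_def by blast+
  \<comment> \<open>With the cell and functional chosen for \<open>s b c\<close>, the left side
    becomes \<open>W (s b c)\<close>.\<close>
  have less: "N * \<beta>' - u' \<bullet> (b - \<pi> b + c) < N * \<beta> b - u b \<bullet> b - \<omega> (\<pi> b) + \<omega> c"
    if "b \<in> B" "S' \<in> T" "supports S' u' \<beta>'" "c \<in> lattice_points P" "\<not> {\<pi> b, c} \<subseteq> S'"
    for b S' u' \<beta>' c
    using splits[OF that(1)] that(2-) unfolding splits_def by blast
  define W where "W b = N * \<beta> b - u b \<bullet> b" for b
  \<comment> \<open>Row \<open>b\<close> is the equation of the color of \<open>\<pi> b\<close>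
    times the monomial of \<open>b - \<pi> b\<close>: \<open>K b\<close> is its support, and
    \<open>s b\<close> shifts the exponents.\<close>
  define K where "K b = {c \<in> lattice_points P. l c = l (\<pi> b)}" for b
  define s where "s b c = b - \<pi> b + c" for b c
  have int: "a \<in> lattice_points UNIV" if "a \<in> lattice_points P" for a
    using that by (auto simp: lattice_points_def)
  have sB: "s b c \<in> B" if "b \<in> B" "c \<in> K b" for b c
  proof -
    \<comment> \<open>The point \<open>s b c / N\<close> is a convex combination of
      \<open>(b - \<pi> b) / (N - 1)\<close> and \<open>c\<close>.\<close>
    have "(1 - 1 / N) *\<^sub>R ((1 / (N - 1)) *\<^sub>R (b - \<pi> b)) + (1 / N) *\<^sub>R c \<in> P"
      using convex diff[OF that(1)] that(2) N(2)
      by (intro convexD) (auto simp: K_def lattice_points_def)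
    also have "(1 - 1 / N) *\<^sub>R ((1 / (N - 1)) *\<^sub>R (b - \<pi> b)) = (1 / N) *\<^sub>R (b - \<pi> b)"
      using N(2) by (simp add: field_simps)
    finally have "(1 / N) *\<^sub>R s b c \<in> P"
      by (simp add: s_def scaleR_add_right)
    moreover have "s b c \<in> lattice_points UNIV"
      using that \<pi>[OF that(1)]
      by (auto simp: s_def B_def K_def dest!: int intro!: lattice_points_closed)
    ultimately show ?thesis by (simp add: B_def)
  qed
  have sW: "W (s b c) < W b - \<omega> (\<pi> b) + \<omega> c" if "b \<in> B" "c \<in> K b" "c \<noteq> \<pi> b" for b c
  proof -
    have c: "c \<in> lattice_points P" "l c = l (\<pi> b)" using that(2) by (auto simp: K_def)
    \<comment> \<open>A common cell would contain an edge joining two vertices of one color.\<close>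
    have "\<not> {\<pi> b, c} \<subseteq> S (s b c)"
      using segment_in_cell[OF S(1)[OF sB[OF that(1,2)]], of "\<pi> b" c] \<pi>[OF that(1)] c that(3) col
      unfolding proper_coloring_def by (metis insert_subset)
    from less[OF that(1) S[OF sB[OF that(1,2)]] c(1) this] show ?thesis
      by (simp add: W_def s_def)
  qed
  \<comment> \<open>A column \<open>b'\<close> determines \<open>c\<close> through
    \<open>b' = s b c\<close>, so each entry is a single monomial in \<open>t\<close> or
    zero.\<close>
  define M where "M b b' = (let c = b' - b + \<pi> b in
    if c \<in> K b then monom (complex_of_real (\<kappa> c)) (\<omega> c) else 0)" for b b'
  have row: "(\<Sum>b'\<in>B. poly (M b b') (of_real t) * v b') =
      (\<Sum>c\<in>K b. of_real (t ^ \<omega> c * \<kappa> c) * v (s b c))" if "b \<in> B" for b t v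
  proof -
    have "(\<Sum>b'\<in>B. poly (M b b') (of_real t) * v b') =
        (\<Sum>b'\<in>s b ` K b. poly (M b b') (of_real t) * v b')"
    proof (rule sum.mono_neutral_right[OF finB])
      show "s b ` K b \<subseteq> B" using sB that by blast
      show "\<forall>b'\<in>B - s b ` K b. poly (M b b') (of_real t) * v b' = 0"
      proof
        fix b' assume b': "b' \<in> B - s b ` K b"
        have "b' = s b (b' - b + \<pi> b)" by (simp add: s_def)
        with b' have "b' - b + \<pi> b \<notin> K b" by blast
        then show "poly (M b b') (of_real t) * v b' = 0"
          by (simp add: M_def)
      qed
    qed
    also have "\<dots> = (\<Sum>c\<in>K b. poly (M b (s b c)) (of_real t) * v (s b c))"
      by (intro sum.reindex_cong[of "s b"]) (auto simp: inj_on_def s_def)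
    also have "\<dots> = (\<Sum>c\<in>K b. of_real (t ^ \<omega> c * \<kappa> c) * v (s b c))"
      by (intro sum.cong) (auto simp: M_def s_def poly_monom)
    finally show ?thesis .
  qed
  have "\<forall>\<^sub>F t in at_right 0. \<forall>v :: real ^ 'd \<Rightarrow> complex.
      (\<forall>b\<in>B. (\<Sum>c\<in>K b. of_real (t ^ \<omega> c * \<kappa> c) * v (s b c)) = 0) \<longrightarrow> (\<forall>b\<in>B. v b = 0)"
    using finB finA \<pi> \<kappa> sB sW
    by (intro weighted_dominance[where \<pi> = \<pi> and W = W]) (auto simp: K_def s_def)
  then have "\<forall>\<^sub>F t in at_right 0. trivial_kernel B B (\<lambda>b b'. poly (M b b') (of_real t))"
    by (simp add: trivial_kernel_def row)
  then obtain \<epsilon> where \<epsilon>: "0 < \<epsilon>"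
    "\<And>t. 0 < t \<Longrightarrow> t < \<epsilon> \<Longrightarrow> trivial_kernel B B (\<lambda>b b'. poly (M b b') (of_real t))"
    by (auto simp: eventually_at_right_field)
  \<comment> \<open>The matrix is treated over the complex numbers; small positive reals supply
    infinitely many good parameters.\<close>
  have "infinite (complex_of_real ` {0<..<\<epsilon>})"
    using \<epsilon>(1) by (simp add: finite_image_iff inj_on_def infinite_Ioo)
  moreover have "complex_of_real ` {0<..<\<epsilon>} \<subseteq> {z. trivial_kernel B B (\<lambda>b b'. poly (M b b') z)}"
    using \<epsilon>(2) by auto
  ultimately have "finite {z. \<not> trivial_kernel B B (\<lambda>b b'. poly (M b b') z)}"
    using finite_subset by (intro finite_nontrivial_kernel finB) blast
  then have "finite (complex_of_real -` {z. \<not> trivial_kernel B B (\<lambda>b b'. poly (M b b') z)})"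
    by (rule finite_vimageI) (simp add: inj_on_def)
  moreover have "\<not> trivial_kernel B B (\<lambda>b b'. poly (M b b') (of_real t))"
    if "\<forall>i\<in>{0..CARD('d)}. system_poly P l \<omega> \<kappa> t i x = 0" for t x
  proof
    assume *: "trivial_kernel B B (\<lambda>b b'. poly (M b b') (of_real t))"
    have "(\<Sum>c\<in>K b. of_real (t ^ \<omega> c * \<kappa> c) * monomial (s b c) x) = 0" if "b \<in> B" for b
    proof -
      \<comment> \<open>A positive multiple of \<open>b - \<pi> b\<close> lies in \<open>P\<close>,
        so the multiplier is a genuine monomial, also where coordinates of \<open>x\<close>
        vanish.\<close>
      have "\<forall>i. 0 \<le> (b - \<pi> b) $ i"
        using nonneg diff[OF that] N(2) by (fastforce simp: zero_le_divide_iff)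
      moreover have "b - \<pi> b \<in> lattice_points UNIV"
        using that \<pi>[OF that] by (auto simp: B_def dest!: int intro!: lattice_points_closed)
      ultimately have "monomial (s b c) x = monomial (b - \<pi> b) x * monomial c x" if "c \<in> K b" for c
        unfolding s_def using that nonneg
        by (intro monomial_add) (auto simp: K_def lattice_points_def)
      then have "(\<Sum>c\<in>K b. of_real (t ^ \<omega> c * \<kappa> c) * monomial (s b c) x) =
          monomial (b - \<pi> b) x * system_poly P l \<omega> \<kappa> t (l (\<pi> b)) x"
        by (simp add: system_poly_def K_def sum_distrib_left mult_ac)
      also have "l (\<pi> b) \<in> {0..CARD('d)}"
        using col \<pi>[OF that] unfolding proper_coloring_def by blast
      then have "system_poly P l \<omega> \<kappa> t (l (\<pi> b)) x = 0"
        using \<open>\<forall>i\<in>{0..CARD('d)}. system_poly P l \<omega> \<kappa> t i x = 0\<close> by blast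
      finally show ?thesis by simp
    qed
    then have "\<forall>b\<in>B. (\<Sum>b'\<in>B. poly (M b b') (of_real t) * monomial b' x) = 0"
      using row[of _ t "\<lambda>b. monomial b x"] by simp
    then have "\<forall>b\<in>B. monomial b x = 0"
      using *[unfolded trivial_kernel_def, THEN spec, of "\<lambda>b. monomial b x"] by (rule mp[rotated])
    \<comment> \<open>The monomial at 0 equals 1 for every \<open>x\<close>, including those with
      zero coordinates.\<close>
    moreover have "0 \<in> B"
      using zero by (simp add: B_def lattice_points_def)
    ultimately show False
      by (force simp: monomial_def)
  qed
  ultimately show ?thesis
    by (elim finite_subset[rotated]) auto
qed

end

theorem theorem5:
  fixes P :: "(real ^ 'd) set"
    and T :: "(real ^ 'd) set set"
    and l :: "real ^ 'd \<Rightarrow> nat"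
    and \<kappa> :: "real ^ 'd \<Rightarrow> real"
  assumes "lattice_polytope P"
    and "aff_dim P = int CARD('d)"
    and "\<forall>x\<in>P. \<forall>i. 0 \<le> x $ i"
    and "lattice_triangulation P T"
    and "regular_triangulation P T"
    and "dense_triangulation P T"
    and "foldable P T"
    and "maximal_cell T standard_simplex"
    and "proper_coloring P T l"
    and "\<forall>a\<in>lattice_points P. 0 < \<kappa> a"
  shows "\<exists>\<omega>. induces P \<omega> T \<and>
    finite {t :: real. t \<noteq> 0 \<and>
      (\<exists>x :: complex ^ 'd. \<forall>i\<in>{0..CARD('d)}. system_poly P l \<omega> \<kappa> t i x = 0)}"
proof -
  obtain \<omega> where \<omega>: "induces P \<omega> T"
    using assms(5) by (auto simp: regular_triangulation_def)
  interpret induced_triangulation P T \<omega>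
    using assms(4,6) \<omega>
    by unfold_locales (auto simp: lattice_triangulation_def dense_triangulation_def)
  have "convex P" "bounded P"
    using assms(1) by (auto simp: lattice_polytope_def finite_imp_bounded bounded_convex_hull)
  \<comment> \<open>The cell \<open>standard_simplex\<close> puts the origin into \<open>P\<close>,
    which supplies the constant monomial.\<close>
  moreover have "0 \<in> standard_simplex"
    unfolding standard_simplex_def by (rule hull_inc) simp
  then have "0 \<in> P"
    using assms(8) union by (auto simp: maximal_cell_def)
  ultimately have "finite {t. \<exists>x. \<forall>i\<in>{0..CARD('d)}. system_poly P l \<omega> \<kappa> t i x = 0}"
    using assms(3,9,10) by (intro finite_solvable_parameters)
  then have "finite {t. t \<noteq> 0 \<and>
      (\<exists>x. \<forall>i\<in>{0..CARD('d)}. system_poly P l \<omega> \<kappa> t i x = 0)}"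
    by (elim finite_subset[rotated]) auto
  with \<omega> show ?thesis by blast
qed

end
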